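(* Let $G=A\rtimes K$ with $A$ and $K$ finite abelian groups, and let $\pi:G\to K$ be the natural projection. For each subgroup $B\le K$ define $C_B:=\mathrm{C}_A(B)$, \[ \Lambda(B):=\{H\le G:\ H\text{ abelian},\ \pi(H)=B,\ H\cap A=C_B\}, \qquad \lambda(B):=|\Lambda(B)|, \] and \[ \varphi_r(B):=\#\{(b_1,\dots,b_r)\in B^r:\ \langle b_1,\dots,b_r\rangle=B\}. \] Then for every $r\ge 1$, \[ |\mathrm{Hom}(\mathbb Z^r,G)|=\sum_{B\le K}\lambda(B)\,|C_B|^r\,\varphi_r(B). \] Equivalently, if $\mu_B(D):=\mu(D,B)$ denotes the Möbius function of the subgroup lattice interval $[D,B]$, then \[ \varphi_r(B)=\sum_{D\le B}\mu_B(D)\,|D|^r \] and therefore \[ |\mathrm{Hom}(\mathbb Z^r,G)|=\sum_{B\le K}\sum_{D\le B}\lambda(B)\,\mu_B(D)\,(|C_B|\,|D|)^r. \]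
   Context: $A$ is the normal factor of $A\rtimes K$, and $\mathrm{C}_A(B)$ is the subgroup of elements of $A$ fixed by every element of $B\le K$ under the action of $K$ on $A$. $\mathrm{Hom}(\mathbb Z^r,G)$ is identified with the set of pairwise commuting $r$-tuples in $G^r$. The Möbius function is that of the lattice of subgroups of $K$ ordered by inclusion. *)

theory Defs
  imports "HOL-Algebra.Algebra"
begin

text \<open>The action of \<open>K\<close> on \<open>A\<close> is a homomorphism \<open>\<theta> \<in> hom K (AutoGroup A)\<close>.\<close>

definition semidirect_product ::
    "('a, 'm) monoid_scheme \<Rightarrow> ('k, 'n) monoid_scheme \<Rightarrow> ('k \<Rightarrow> 'a \<Rightarrow> 'a) \<Rightarrow> ('a \<times> 'k) monoid"
  where "semidirect_product A K \<theta> =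
    \<lparr>carrier = carrier A \<times> carrier K,
     monoid.mult = (\<lambda>(a, k) (a', k'). (a \<otimes>\<^bsub>A\<^esub> \<theta> k a', k \<otimes>\<^bsub>K\<^esub> k')),
     monoid.one = (\<one>\<^bsub>A\<^esub>, \<one>\<^bsub>K\<^esub>)\<rparr>"

lemma group_semidirect_product:
  assumes A: "group A" and K: "group K" and \<theta>: "\<theta> \<in> hom K (AutoGroup A)"
  shows "group (semidirect_product A K \<theta>)"
proof -
  interpret A: group A by (rule A)
  interpret K: group K by (rule K)
  have auto: "\<theta> k \<in> auto A" if "k \<in> carrier K" for k
    using \<theta> that by (auto simp: hom_def AutoGroup_def)
  have closed: "\<theta> k a \<in> carrier A" if "k \<in> carrier K" "a \<in> carrier A" for k a
    using auto[OF that(1)] that(2) by (auto simp: auto_def hom_def)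
  have mult: "\<theta> k (a \<otimes>\<^bsub>A\<^esub> b) = \<theta> k a \<otimes>\<^bsub>A\<^esub> \<theta> k b"
    if "k \<in> carrier K" "a \<in> carrier A" "b \<in> carrier A" for k a b
    using auto[OF that(1)] that(2,3) by (auto simp: auto_def hom_def)
  have comp: "\<theta> (k \<otimes>\<^bsub>K\<^esub> l) a = \<theta> k (\<theta> l a)"
    if "k \<in> carrier K" "l \<in> carrier K" "a \<in> carrier A" for k l a
  proof -
    have "\<theta> (k \<otimes>\<^bsub>K\<^esub> l) = compose (carrier A) (\<theta> k) (\<theta> l)"
      using \<theta> that auto[OF that(1)] auto[OF that(2)]
      by (auto simp: hom_def AutoGroup_def BijGroup_def auto_def)
    then show ?thesis using that by (simp add: compose_def)
  qed
  have one: "\<theta> \<one>\<^bsub>K\<^esub> a = a" if a: "a \<in> carrier A" for a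
  proof -
    have "inj_on (\<theta> \<one>\<^bsub>K\<^esub>) (carrier A)"
      using auto[OF K.one_closed] by (auto simp: auto_def Bij_def bij_betw_def)
    moreover have "\<theta> \<one>\<^bsub>K\<^esub> (\<theta> \<one>\<^bsub>K\<^esub> a) = \<theta> \<one>\<^bsub>K\<^esub> a"
      using comp[OF K.one_closed K.one_closed a] by simp
    ultimately show ?thesis
      using a closed[OF K.one_closed a] by (auto dest: inj_onD)
  qed
  show ?thesis
  proof (rule groupI)
    fix x assume "x \<in> carrier (semidirect_product A K \<theta>)"
    then obtain a k where x: "x = (a, k)" "a \<in> carrier A" "k \<in> carrier K"
      by (auto simp: semidirect_product_def)
    let ?k = "inv\<^bsub>K\<^esub> k"
    have "(inv\<^bsub>A\<^esub> (\<theta> ?k a), ?k) \<otimes>\<^bsub>semidirect_product A K \<theta>\<^esub> x = \<one>\<^bsub>semidirect_product A K \<theta>\<^esub>"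
      using x closed by (simp add: semidirect_product_def)
    then show "\<exists>y\<in>carrier (semidirect_product A K \<theta>).
        y \<otimes>\<^bsub>semidirect_product A K \<theta>\<^esub> x = \<one>\<^bsub>semidirect_product A K \<theta>\<^esub>"
      using x closed
      by (intro bexI[of _ "(inv\<^bsub>A\<^esub> (\<theta> ?k a), ?k)"]) (auto simp: semidirect_product_def)
  qed (auto simp: semidirect_product_def closed mult comp one A.m_assoc K.m_assoc)
qed

definition fixed_points ::
    "('a, 'm) monoid_scheme \<Rightarrow> ('k \<Rightarrow> 'a \<Rightarrow> 'a) \<Rightarrow> 'k set \<Rightarrow> 'a set"
  where "fixed_points A \<theta> B = {a \<in> carrier A. \<forall>b\<in>B. \<theta> b a = a}"

text \<open>A subset \<open>S\<close> of \<open>A\<close> is regarded as the subset \<open>S \<times> {\<one>}\<close> of the semidirect product, and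
  the natural projection to \<open>K\<close> is \<^const>\<open>snd\<close>.\<close>

definition Lambda ::
    "('a, 'm) monoid_scheme \<Rightarrow> ('k, 'n) monoid_scheme \<Rightarrow> ('k \<Rightarrow> 'a \<Rightarrow> 'a) \<Rightarrow> 'k set
      \<Rightarrow> ('a \<times> 'k) set set"
  where "Lambda A K \<theta> B =
    {H. subgroup H (semidirect_product A K \<theta>) \<and>
        comm_group (semidirect_product A K \<theta>\<lparr>carrier := H\<rparr>) \<and>
        snd ` H = B \<and>
        H \<inter> (carrier A \<times> {\<one>\<^bsub>K\<^esub>}) = fixed_points A \<theta> B \<times> {\<one>\<^bsub>K\<^esub>}}"

definition lambda ::
    "('a, 'm) monoid_scheme \<Rightarrow> ('k, 'n) monoid_scheme \<Rightarrow> ('k \<Rightarrow> 'a \<Rightarrow> 'a) \<Rightarrow> 'k set \<Rightarrow> nat"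
  where "lambda A K \<theta> B = card (Lambda A K \<theta> B)"

definition gen_tuples :: "('k, 'n) monoid_scheme \<Rightarrow> nat \<Rightarrow> 'k set \<Rightarrow> nat"
  where "gen_tuples K r B = card {b \<in> {..<r} \<rightarrow>\<^sub>E B. generate K (b ` {..<r}) = B}"

text \<open>\<^const>\<open>hom\<close> does not constrain functions outside the carrier of the domain; restricting to
  extensional functions makes each homomorphism be counted exactly once.\<close>

definition Hom_Zpow :: "nat \<Rightarrow> ('g, 'n) monoid_scheme \<Rightarrow> ((nat \<Rightarrow> int) \<Rightarrow> 'g) set"
  where "Hom_Zpow r G =
    hom (product_group {..<r} (\<lambda>_. integer_group)) G
      \<inter> extensional (carrier (product_group {..<r} (\<lambda>_. integer_group)))"

text \<open>The Moebius function of the poset \<open>P\<close> with the order of its type. Only arguments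
  \<open>x, y \<in> P\<close> with finite interval \<open>[x, y]\<close> are meaningful.\<close>

function moebius :: "'b::order set \<Rightarrow> 'b \<Rightarrow> 'b \<Rightarrow> int"
  where "moebius P x y =
    (if x = y then 1
     else if x < y \<and> finite {z \<in> P. x \<le> z \<and> z < y}
       then - (\<Sum>z\<in>{z \<in> P. x \<le> z \<and> z < y}. moebius P x z)
     else 0)"
  by pat_completeness auto
termination
proof (relation "measure (\<lambda>(P, x, y). card {z \<in> P. x \<le> z \<and> z < y})")
  fix P :: "'b::order set" and x y z
  assume "x < y \<and> finite {z \<in> P. x \<le> z \<and> z < y}" "z \<in> {z \<in> P. x \<le> z \<and> z < y}"
  then show "((P, x, z), P, x, y) \<in> measure (\<lambda>(P, x, y). card {z \<in> P. x \<le> z \<and> z < y})"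
    by (auto intro!: psubset_card_mono)
qed simp

declare moebius.simps [simp del]

end

theory Submission
  imports Defs
begin

text \<open>
  A homomorphism from \<open>\<int>\<^sup>r\<close> to \<open>G = A \<rtimes> K\<close> is a commuting \<open>r\<close>-tuple \<open>x\<close> in \<open>G\<close>. Let \<open>B\<close> be the
  subgroup of \<open>K\<close> generated by the projections of \<open>x\<close>. An element of \<open>A\<close> commutes with an element of
  \<open>G\<close> over \<open>b\<close> iff it is fixed by \<open>b\<close>, so \<open>\<langle>x\<rangle> C\<^sub>B\<close> is abelian, meets \<open>A\<close> in \<open>C\<^sub>B\<close>, and is the unique
  member of \<open>\<Lambda>(B)\<close> containing \<open>x\<close>. Conversely each \<open>H \<in> \<Lambda>(B)\<close> projects onto \<open>B\<close> with fibres of size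
  \<open>|C\<^sub>B|\<close>, so each generating \<open>r\<close>-tuple of \<open>B\<close> lifts to \<open>|C\<^sub>B|\<^sup>r\<close> tuples in \<open>H\<close>. The formula for
  \<open>\<phi>\<^sub>r\<close> is Moebius inversion of \<open>|B|\<^sup>r = \<Sum>\<^bsub>D \<le> B\<^esub> \<phi>\<^sub>r(D)\<close>.
\<close>

section \<open>Commuting elements and the subgroups they generate\<close>

lemma (in group) commute_inv:
  assumes "g \<in> carrier G" "h \<in> carrier G" "g \<otimes> h = h \<otimes> g"
  shows "g \<otimes> inv h = inv h \<otimes> g"
proof -
  \<comment> \<open>Multiplying the relation by \<open>inv h\<close> on both sides cancels
    \<open>h\<close> on opposite sides.\<close>
  have "inv h \<otimes> (g \<otimes> h) \<otimes> inv h = inv h \<otimes> (h \<otimes> g) \<otimes> inv h"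
    using assms(3) by simp
  then show ?thesis
    using assms(1,2) by (metis inv_closed l_inv l_one m_assoc m_closed r_inv r_one)
qed

text \<open>The centralizer of \<open>g\<close> is closed under products and inverses, so containing
  \<open>S\<close> it contains the subgroup generated by \<open>S\<close>.\<close>

lemma (in group) commute_generate:
  assumes S: "S \<subseteq> carrier G" and g: "g \<in> carrier G"
    and comm: "\<And>s. s \<in> S \<Longrightarrow> g \<otimes> s = s \<otimes> g" and h: "h \<in> generate G S"
  shows "g \<otimes> h = h \<otimes> g"
  using h
proof induction
  case one
  then show ?case using g by simp
next
  case (incl h)
  then show ?case by (rule comm)
next
  case (inv h)
  then show ?case using S g comm by (intro commute_inv) auto
next
  case (eng h k)
  then have "h \<in> carrier G" "k \<in> carrier G"
    using generate_in_carrier[OF S] by auto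
  then show ?case using eng g by (metis m_assoc)
qed

lemma (in group) comm_group_generate:
  assumes S: "S \<subseteq> carrier G" and comm: "\<And>s t. s \<in> S \<Longrightarrow> t \<in> S \<Longrightarrow> s \<otimes> t = t \<otimes> s"
  shows "comm_group (G\<lparr>carrier := generate G S\<rparr>)"
proof (rule group.group_comm_groupI)
  show "group (G\<lparr>carrier := generate G S\<rparr>)"
    by (intro subgroup_imp_group generate_is_subgroup S)
  fix h k assume "h \<in> carrier (G\<lparr>carrier := generate G S\<rparr>)" "k \<in> carrier (G\<lparr>carrier := generate G S\<rparr>)"
  then have h: "h \<in> generate G S" and k: "k \<in> generate G S" by auto
  \<comment> \<open>The centralizer argument is used twice: first with a generator \<open>s\<close>
    in the role of the fixed element, then with \<open>h\<close> itself.\<close>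
  have "h \<otimes> s = s \<otimes> h" if "s \<in> S" for s
    using commute_generate[OF S _ _ h, of s] comm S that by (metis subsetD)
  then show "h \<otimes>\<^bsub>G\<lparr>carrier := generate G S\<rparr>\<^esub> k = k \<otimes>\<^bsub>G\<lparr>carrier := generate G S\<rparr>\<^esub> h"
    using commute_generate[OF S generate_in_carrier[OF S h] _ k] by simp
qed

section \<open>Homomorphisms from the free abelian group of rank r as commuting tuples\<close>

definition commuting_tuples :: "nat \<Rightarrow> ('g, 'n) monoid_scheme \<Rightarrow> (nat \<Rightarrow> 'g) set"
  where "commuting_tuples r G =
    {x \<in> {..<r} \<rightarrow>\<^sub>E carrier G. \<forall>i<r. \<forall>j<r. x i \<otimes>\<^bsub>G\<^esub> x j = x j \<otimes>\<^bsub>G\<^esub> x i}"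

definition unit_tuple :: "nat \<Rightarrow> nat \<Rightarrow> nat \<Rightarrow> int"
  where "unit_tuple r i = (\<lambda>j\<in>{..<r}. if j = i then 1 else 0)"

abbreviation Zpow :: "nat \<Rightarrow> (nat \<Rightarrow> int) monoid"
  where "Zpow r \<equiv> product_group {..<r} (\<lambda>_. integer_group)"

text \<open>Uniqueness half of the universal property: the unit tuples generate
  \<open>Zpow r\<close>, and \<open>v\<close> is built up one coordinate at a time.\<close>

lemma (in group) hom_Zpow_eqI:
  assumes f: "f \<in> hom (Zpow r) G" and g: "g \<in> hom (Zpow r) G"
    and eq: "\<And>i. i < r \<Longrightarrow> f (unit_tuple r i) = g (unit_tuple r i)"
    and v: "v \<in> carrier (Zpow r)"
  shows "f v = g v"
proof -
  \<comment> \<open>\<open>w n\<close> keeps the first \<open>n\<close> coordinates of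
    \<open>v\<close>, so it runs from the identity to \<open>v\<close>; \<open>e i k\<close> is
    \<open>k\<close> times the \<open>i\<close>-th unit tuple.\<close>
  define w where "w n = (\<lambda>j\<in>{..<r}. if j < n then v j else 0)" for n
  define e where "e i k = (\<lambda>j\<in>{..<r}. if j = i then k else (0::int))" for i k
  have Z: "group (Zpow r)" by simp
  have e_hom: "e i \<in> hom integer_group (Zpow r)" for i
    by (auto simp: hom_def e_def)
  \<comment> \<open>Composing \<open>h\<close> with \<open>e i\<close> gives a homomorphism from the
    integers, which is determined by its value at 1.\<close>
  have e_pow: "h (e i k) = h (e i 1) [^] k" if "h \<in> hom (Zpow r) G" for h i k
    using hom_int_pow[OF Group.hom_compose[OF e_hom that], of 1 i k] is_group by simp
  have step: "f (e i k) = g (e i k)" if "i < r" for i k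
    using e_pow[OF f, of i k] e_pow[OF g, of i k] eq[OF that] by (simp add: e_def unit_tuple_def)
  have w_Suc: "w (Suc n) = w n \<otimes>\<^bsub>Zpow r\<^esub> e n (v n)" for n
    by (auto simp: w_def e_def fun_eq_iff)
  have "f (w n) = g (w n)" if "n \<le> r" for n
    using that
  proof (induction n)
    case 0
    have "w 0 = \<one>\<^bsub>Zpow r\<^esub>" by (simp add: w_def)
    then show ?case using hom_one[OF f Z is_group] hom_one[OF g Z is_group] by metis
  next
    case (Suc n)
    have "w n \<in> carrier (Zpow r)" "e n (v n) \<in> carrier (Zpow r)"
      by (auto simp: w_def e_def)
    then show ?case
      unfolding w_Suc using Suc step[of n] by (simp only: hom_mult[OF f] hom_mult[OF g] Suc_leD Suc_le_lessD)
  qed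
  moreover have "w r = v"
    using v by (auto simp: w_def fun_eq_iff PiE_def extensional_def)
  ultimately show ?thesis by auto
qed

text \<open>Existence half of the universal property: send \<open>v\<close> to the product of the
  powers of the \<open>x i\<close> with exponents \<open>v i\<close>. This is multiplicative because
  the \<open>x i\<close> commute.\<close>

lemma (in group) hom_Zpow_extends:
  assumes x: "x \<in> commuting_tuples r G"
  obtains f where "f \<in> hom (Zpow r) G" "\<And>i. i < r \<Longrightarrow> f (unit_tuple r i) = x i"
proof -
  have S: "x ` {..<r} \<subseteq> carrier G"
    using x by (auto simp: commuting_tuples_def)
  \<comment> \<open>\<open>finprod\<close> needs a commutative group, so the product is formed in
    the abelian subgroup generated by the entries of \<open>x\<close>.\<close>
  define H where "H = G\<lparr>carrier := generate G (x ` {..<r})\<rparr>"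
  interpret H: comm_group H
    unfolding H_def using x by (intro comm_group_generate S) (auto simp: commuting_tuples_def)
  have xH: "x i \<in> carrier H" if "i < r" for i
    using that by (auto simp: H_def intro: generate.incl)
  define f where "f v = finprod H (\<lambda>i. x i [^]\<^bsub>H\<^esub> (v i :: int)) {..<r}" for v
  have "f \<in> hom (Zpow r) H"
  proof (rule homI)
    fix v w
    have "f (v \<otimes>\<^bsub>Zpow r\<^esub> w) = finprod H (\<lambda>i. x i [^]\<^bsub>H\<^esub> v i \<otimes>\<^bsub>H\<^esub> x i [^]\<^bsub>H\<^esub> w i) {..<r}"
      unfolding f_def using xH H.int_pow_closed
      by (intro H.finprod_cong') (auto simp: H.int_pow_mult)
    also have "\<dots> = f v \<otimes>\<^bsub>H\<^esub> f w"
      unfolding f_def by (rule H.finprod_multf) (auto intro!: H.int_pow_closed xH)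
    finally show "f (v \<otimes>\<^bsub>Zpow r\<^esub> w) = f v \<otimes>\<^bsub>H\<^esub> f w" .
  qed (unfold f_def, auto intro!: H.finprod_closed H.int_pow_closed xH)
  then have "f \<in> hom (Zpow r) G"
    using generate_in_carrier[OF S] by (auto simp: hom_def H_def)
  moreover have "f (unit_tuple r i) = x i" if "i < r" for i
  proof -
    have "f (unit_tuple r i) = finprod H (\<lambda>j. if i = j then x j else \<one>\<^bsub>H\<^esub>) {..<r}"
      unfolding f_def unit_tuple_def using xH
      by (intro H.finprod_cong') auto
    also have "\<dots> = x i"
      using that xH by (intro H.finprod_singleton) auto
    finally show ?thesis .
  qed
  ultimately show ?thesis using that by blast
qed

text \<open>Evaluation at the unit tuples is the bijection: \<open>hom_Zpow_eqI\<close> makes it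
  injective, \<open>hom_Zpow_extends\<close> surjective.\<close>

lemma (in group) card_Hom_Zpow:
  "card (Hom_Zpow r G) = card (commuting_tuples r G)"
proof (rule bij_betw_same_card)
  let ?e = "\<lambda>f. \<lambda>i\<in>{..<r}. f (unit_tuple r i)"
  have unit: "unit_tuple r i \<in> carrier (Zpow r)" for i
    by (auto simp: unit_tuple_def)
  show "bij_betw ?e (Hom_Zpow r G) (commuting_tuples r G)"
  proof (rule bij_betw_imageI)
    show "inj_on ?e (Hom_Zpow r G)"
    proof (rule inj_onI)
      fix f g assume f: "f \<in> Hom_Zpow r G" and g: "g \<in> Hom_Zpow r G" and "?e f = ?e g"
      then have eq: "f (unit_tuple r i) = g (unit_tuple r i)" if "i < r" for i
        using that by (metis lessThan_iff restrict_apply')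
      show "f = g"
      proof (rule extensionalityI)
        show "f \<in> extensional (carrier (Zpow r))" "g \<in> extensional (carrier (Zpow r))"
          using f g by (simp_all only: Hom_Zpow_def Int_iff)
        show "f v = g v" if "v \<in> carrier (Zpow r)" for v
          using f g eq that hom_Zpow_eqI[of f r g v] by (simp only: Hom_Zpow_def Int_iff)
      qed
    qed
    show "?e ` Hom_Zpow r G = commuting_tuples r G"
    proof (intro equalityI subsetI)
      fix x assume "x \<in> ?e ` Hom_Zpow r G"
      then obtain f where f: "f \<in> hom (Zpow r) G" and x: "x = ?e f"
        unfolding Hom_Zpow_def by blast
      have "f u \<otimes> f v = f v \<otimes> f u" if "u \<in> carrier (Zpow r)" "v \<in> carrier (Zpow r)" for u v
      proof -
        have "u \<otimes>\<^bsub>Zpow r\<^esub> v = v \<otimes>\<^bsub>Zpow r\<^esub> u" by (simp add: add.commute)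
        then show ?thesis using hom_mult[OF f that] hom_mult[OF f that(2,1)] by simp
      qed
      then show "x \<in> commuting_tuples r G"
        using unit hom_in_carrier[OF f unit] by (simp add: commuting_tuples_def x)
    next
      fix x assume x: "x \<in> commuting_tuples r G"
      then obtain f where f: "f \<in> hom (Zpow r) G" and fx: "\<And>i. i < r \<Longrightarrow> f (unit_tuple r i) = x i"
        using hom_Zpow_extends by blast
      interpret Z: group "Zpow r" by simp
      \<comment> \<open>The extension \<open>f\<close> is arbitrary outside the carrier; restricting
        it gives the extensional representative.\<close>
      have "restrict f (carrier (Zpow r)) \<in> hom (Zpow r) G"
        using hom_in_carrier[OF f] hom_mult[OF f] Z.m_closed
        by (intro homI) (simp_all only: restrict_apply')
      then have "restrict f (carrier (Zpow r)) \<in> Hom_Zpow r G"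
        unfolding Hom_Zpow_def by (blast intro: restrict_extensional)
      moreover have "x = ?e (restrict f (carrier (Zpow r)))"
      proof (rule extensionalityI)
        show "x \<in> extensional {..<r}" using x by (simp add: commuting_tuples_def PiE_def)
      qed (use fx unit in \<open>simp_all del: carrier_product_group\<close>)
      ultimately show "x \<in> ?e ` Hom_Zpow r G" by blast
    qed
  qed
qed

section \<open>Moebius inversion over a finite poset\<close>

text \<open>The recursion for \<open>moebius\<close>, with the top term \<open>z = y\<close> brought
  back into the sum.\<close>

lemma sum_moebius:
  fixes P :: "'b::order set"
  assumes P: "finite P" and xy: "x \<in> P" "y \<in> P" "x \<le> y"
  shows "(\<Sum>z\<in>{z \<in> P. x \<le> z \<and> z \<le> y}. moebius P x z) = (if x = y then 1 else 0)"
proof (cases "x = y")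
  case True
  then have "{z \<in> P. x \<le> z \<and> z \<le> y} = {x}" using xy by auto
  then show ?thesis using True by (simp add: moebius.simps)
next
  case False
  have "moebius P x y = - (\<Sum>z\<in>{z \<in> P. x \<le> z \<and> z < y}. moebius P x z)"
    by (rule trans[OF moebius.simps]) (use False P xy in \<open>simp add: less_le\<close>)
  moreover have "{z \<in> P. x \<le> z \<and> z \<le> y} = insert y {z \<in> P. x \<le> z \<and> z < y}" using xy by auto
  ultimately show ?thesis
    using False P by simp
qed

text \<open>The recursion defining \<^const>\<open>moebius\<close> only says that it is an inverse of the zeta function
  on one side; comparing the partial sums of both sides of the claim avoids the other side.\<close>

lemma moebius_inversion:
  fixes P :: "'b::order set" and f g :: "'b \<Rightarrow> int"
  assumes P: "finite P" and f: "\<And>y. y \<in> P \<Longrightarrow> f y = (\<Sum>x\<in>{x \<in> P. x \<le> y}. g x)"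
    and y: "y \<in> P"
  shows "g y = (\<Sum>x\<in>{x \<in> P. x \<le> y}. moebius P x y * f x)"
proof -
  define h where "h y = (\<Sum>x\<in>{x \<in> P. x \<le> y}. moebius P x y * f x)" for y
  have h: "(\<Sum>z\<in>{z \<in> P. z \<le> y}. h z) = f y" if y: "y \<in> P" for y
  proof -
    have "(\<Sum>z\<in>{z \<in> P. z \<le> y}. h z) =
      (\<Sum>z\<in>{z \<in> P. z \<le> y}. \<Sum>x\<in>{x \<in> {x \<in> P. x \<le> y}. x \<le> z}. moebius P x z * f x)"
      unfolding h_def by (intro sum.cong) auto
    \<comment> \<open>After the exchange the inner sum runs over the interval from \<open>x\<close>
      to \<open>y\<close>, where \<open>sum_moebius\<close> leaves only
      \<open>x = y\<close>.\<close>
    also have "\<dots> = (\<Sum>x\<in>{x \<in> P. x \<le> y}. \<Sum>z\<in>{z \<in> {z \<in> P. z \<le> y}. x \<le> z}. moebius P x z * f x)"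
      using P by (intro sum.swap_restrict) auto
    also have "\<dots> = (\<Sum>x\<in>{x \<in> P. x \<le> y}. if x = y then f x else 0)"
    proof (rule sum.cong[OF refl])
      fix x assume x: "x \<in> {x \<in> P. x \<le> y}"
      have "{z \<in> {z \<in> P. z \<le> y}. x \<le> z} = {z \<in> P. x \<le> z \<and> z \<le> y}" by auto
      then show "(\<Sum>z\<in>{z \<in> {z \<in> P. z \<le> y}. x \<le> z}. moebius P x z * f x) = (if x = y then f x else 0)"
        using sum_moebius[OF P _ y, of x] x by (simp flip: sum_distrib_right)
    qed
    also have "\<dots> = f y" using P y by (simp add: sum.delta)
    finally show ?thesis .
  qed
  have "g y = h y"
    using y
  \<comment> \<open>\<open>g\<close> and \<open>h\<close> have equal partial sums up to
    \<open>y\<close> and agree strictly below \<open>y\<close>, so the top terms agree.\<close>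
  proof (induction "card {x \<in> P. x < y}" arbitrary: y rule: less_induct)
    case less
    have "g x = h x" if "x \<in> {x \<in> P. x < y}" for x
      using that P by (intro less.hyps psubset_card_mono) auto
    then have "(\<Sum>x\<in>{x \<in> P. x < y}. g x) = (\<Sum>x\<in>{x \<in> P. x < y}. h x)" by (rule sum.cong[OF refl])
    moreover have "{x \<in> P. x \<le> y} = insert y {x \<in> P. x < y}" using less.prems by auto
    ultimately show ?case
      using f[OF less.prems] h[OF less.prems] P by simp
  qed
  then show ?thesis by (simp add: h_def)
qed

section \<open>Counting tuples by the subgroup they generate\<close>

text \<open>The block of commuting tuples that the pair of \<open>B\<close> and \<open>H\<close> in
  \<open>Lambda A K \<theta> B\<close> accounts for in the final count.\<close>

definition tuples_over :: "('k, 'n) monoid_scheme \<Rightarrow> nat \<Rightarrow> ('a \<times> 'k) set \<Rightarrow> 'k set \<Rightarrow> (nat \<Rightarrow> 'a \<times> 'k) set"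
  where "tuples_over K r H B = {x \<in> {..<r} \<rightarrow>\<^sub>E H. generate K (snd ` x ` {..<r}) = B}"

lemma (in group) finite_subgroups:
  "finite (carrier G) \<Longrightarrow> finite {H. subgroup H G}"
  by (rule finite_subset[of _ "Pow (carrier G)"]) (auto dest: subgroup.subset)

text \<open>Each tuple in \<open>B\<close> generates exactly one subgroup \<open>D\<close> of
  \<open>B\<close>, which partitions all tuples in \<open>B\<close>.\<close>

lemma (in group) card_power_eq_sum_gen_tuples:
  assumes fin: "finite (carrier G)" and B: "subgroup B G"
  shows "card B ^ r = (\<Sum>D | subgroup D G \<and> D \<subseteq> B. gen_tuples G r D)"
proof -
  let ?S = "{D. subgroup D G \<and> D \<subseteq> B}"
  let ?T = "\<lambda>D. {b \<in> {..<r} \<rightarrow>\<^sub>E D. generate G (b ` {..<r}) = D}"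
  have finB: "finite B"
    using fin subgroup.subset[OF B] by (rule rev_finite_subset)
  have "{..<r} \<rightarrow>\<^sub>E B = (\<Union>D\<in>?S. ?T D)"
  proof (intro equalityI subsetI)
    fix b assume b: "b \<in> {..<r} \<rightarrow>\<^sub>E B"
    then have sub: "b ` {..<r} \<subseteq> B" by auto
    let ?D = "generate G (b ` {..<r})"
    have "?D \<in> ?S"
      using generate_subgroup_incl[OF sub B] generate_is_subgroup sub subgroup.subset[OF B] by blast
    moreover have "b \<in> ?T ?D"
      using b by (auto simp: PiE_iff intro: generate.incl)
    ultimately show "b \<in> (\<Union>D\<in>?S. ?T D)" by blast
  next
    fix b assume "b \<in> (\<Union>D\<in>?S. ?T D)"
    then show "b \<in> {..<r} \<rightarrow>\<^sub>E B" by (auto simp: PiE_iff)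
  qed
  moreover have "card (\<Union>D\<in>?S. ?T D) = (\<Sum>D\<in>?S. card (?T D))"
  proof (intro card_UN_disjoint ballI impI)
    show "finite ?S" using finite_subgroups[OF fin] by simp
    fix D assume "D \<in> ?S"
    then have "finite D" using finB by (auto intro: finite_subset)
    then show "finite (?T D)" by (simp add: finite_PiE)
  qed auto
  moreover have "card ({..<r} \<rightarrow>\<^sub>E B) = card B ^ r"
    by (simp add: card_PiE)
  ultimately show ?thesis by (simp add: gen_tuples_def)
qed

lemma (in group) gen_tuples_eq_sum_moebius:
  assumes fin: "finite (carrier G)" and B: "subgroup B G"
  shows "int (gen_tuples G r B)
    = (\<Sum>D | subgroup D G \<and> D \<subseteq> B. moebius {H. subgroup H G} D B * int (card D) ^ r)"
proof -
  have "int (card D) ^ r = (\<Sum>E\<in>{E \<in> {H. subgroup H G}. E \<subseteq> D}. int (gen_tuples G r E))"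
    if "D \<in> {H. subgroup H G}" for D
    using card_power_eq_sum_gen_tuples[OF fin, of D r] that
    by (simp flip: of_nat_power of_nat_sum)
  from moebius_inversion[OF finite_subgroups[OF fin] this, of B] B show ?thesis by simp
qed

section \<open>The semidirect product and its projection\<close>

locale semidirect = A: comm_group A + K: comm_group K
  for A :: "('a, 'm) monoid_scheme" and K :: "('k, 'n) monoid_scheme" +
  fixes \<theta> :: "'k \<Rightarrow> 'a \<Rightarrow> 'a"
  assumes action: "\<theta> \<in> hom K (AutoGroup A)"
    and finite_A: "finite (carrier A)" and finite_K: "finite (carrier K)"
begin

definition G where "G = semidirect_product A K \<theta>"

sublocale G: group G
  unfolding G_def by (intro group_semidirect_product A.is_group K.is_group action)

lemma carrier_G [simp]: "carrier G = carrier A \<times> carrier K"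
  by (simp add: G_def semidirect_product_def)

lemma one_G [simp]: "\<one>\<^bsub>G\<^esub> = (\<one>\<^bsub>A\<^esub>, \<one>\<^bsub>K\<^esub>)"
  by (simp add: G_def semidirect_product_def)

lemma mult_G [simp]: "(a, k) \<otimes>\<^bsub>G\<^esub> (a', k') = (a \<otimes>\<^bsub>A\<^esub> \<theta> k a', k \<otimes>\<^bsub>K\<^esub> k')"
  by (simp add: G_def semidirect_product_def)

lemma action_closed [simp]: "k \<in> carrier K \<Longrightarrow> a \<in> carrier A \<Longrightarrow> \<theta> k a \<in> carrier A"
  using hom_in_carrier[OF action, of k]
  by (auto simp: AutoGroup_def auto_def hom_def)

lemma action_one [simp]: "a \<in> carrier A \<Longrightarrow> \<theta> \<one>\<^bsub>K\<^esub> a = a"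
  \<comment> \<open>The left unit law of \<open>G\<close>, read in the first coordinate.\<close>
  using G.l_one[of "(a, \<one>\<^bsub>K\<^esub>)"] by simp

sublocale proj: group_hom G K snd
  by (intro group_hom.intro group_hom_axioms.intro G.is_group K.is_group homI) auto

text \<open>Two elements of one fibre differ by an element of the kernel of \<open>snd\<close>, that
  is, of the copy of \<open>A\<close> in \<open>G\<close>.\<close>

lemma proj_quotient_eq_one:
  assumes g: "g \<in> carrier G" and h: "h \<in> carrier G" and eq: "snd g = snd h"
  shows "snd (h \<otimes>\<^bsub>G\<^esub> inv\<^bsub>G\<^esub> g) = \<one>\<^bsub>K\<^esub>"
proof -
  have "snd (h \<otimes>\<^bsub>G\<^esub> inv\<^bsub>G\<^esub> g) = snd h \<otimes>\<^bsub>K\<^esub> inv\<^bsub>K\<^esub> (snd g)"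
    using proj.hom_mult[OF h G.inv_closed[OF g]] proj.hom_inv[OF g] by simp
  then show ?thesis using proj.hom_closed[OF g] eq by simp
qed

text \<open>As \<open>A\<close> is abelian, the two products differ only in having \<open>c\<close>
  or \<open>\<theta> b c\<close> next to \<open>a\<close>, and \<open>a\<close> cancels.\<close>

lemma commute_fixed_iff:
  assumes "c \<in> carrier A" "a \<in> carrier A" "b \<in> carrier K"
  shows "(c, \<one>\<^bsub>K\<^esub>) \<otimes>\<^bsub>G\<^esub> (a, b) = (a, b) \<otimes>\<^bsub>G\<^esub> (c, \<one>\<^bsub>K\<^esub>) \<longleftrightarrow> \<theta> b c = c"
proof -
  have "(c, \<one>\<^bsub>K\<^esub>) \<otimes>\<^bsub>G\<^esub> (a, b) = (a \<otimes>\<^bsub>A\<^esub> c, b)"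
    using assms A.m_comm[OF assms(1,2)] by simp
  moreover have "(a, b) \<otimes>\<^bsub>G\<^esub> (c, \<one>\<^bsub>K\<^esub>) = (a \<otimes>\<^bsub>A\<^esub> \<theta> b c, b)"
    using assms by simp
  ultimately show ?thesis
    using A.l_cancel[of a c "\<theta> b c"] assms by auto
qed

section \<open>Existence, uniqueness and fibres of the members of
  \<open>Lambda A K \<theta> B\<close>\<close>

lemma finite_Lambda: "finite (Lambda A K \<theta> B)"
proof (rule finite_subset)
  show "Lambda A K \<theta> B \<subseteq> {H. subgroup H G}" by (auto simp: Lambda_def G_def)
  show "finite {H. subgroup H G}" using finite_A finite_K by (intro G.finite_subgroups) simp
qed

lemma LambdaD:
  assumes "H \<in> Lambda A K \<theta> B"
  shows "subgroup H G" "\<And>g h. g \<in> H \<Longrightarrow> h \<in> H \<Longrightarrow> g \<otimes>\<^bsub>G\<^esub> h = h \<otimes>\<^bsub>G\<^esub> g" "snd ` H = B"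
    "H \<inter> (carrier A \<times> {\<one>\<^bsub>K\<^esub>}) = fixed_points A \<theta> B \<times> {\<one>\<^bsub>K\<^esub>}"
proof -
  have H: "subgroup H G" "comm_group (G\<lparr>carrier := H\<rparr>)"
    using assms by (auto simp: Lambda_def G_def)
  then show "subgroup H G" by simp
  interpret H: comm_group "G\<lparr>carrier := H\<rparr>" by (rule H)
  show "\<And>g h. g \<in> H \<Longrightarrow> h \<in> H \<Longrightarrow> g \<otimes>\<^bsub>G\<^esub> h = h \<otimes>\<^bsub>G\<^esub> g"
    using H.m_comm by simp
  show "snd ` H = B" "H \<inter> (carrier A \<times> {\<one>\<^bsub>K\<^esub>}) = fixed_points A \<theta> B \<times> {\<one>\<^bsub>K\<^esub>}"
    using assms by (auto simp: Lambda_def)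
qed

text \<open>The right-hand side depends on \<open>B\<close> alone, so a kernel element lies in all
  members of \<open>Lambda A K \<theta> B\<close> or in none.\<close>

lemma Lambda_kernel_iff:
  assumes "H \<in> Lambda A K \<theta> B" "h \<in> carrier G" "snd h = \<one>\<^bsub>K\<^esub>"
  shows "h \<in> H \<longleftrightarrow> h \<in> fixed_points A \<theta> B \<times> {\<one>\<^bsub>K\<^esub>}"
  using assms(2,3) by (subst LambdaD(4)[OF assms(1), symmetric]) auto

text \<open>The witness is the subgroup generated by the entries of \<open>x\<close> together with
  the fixed points of \<open>B\<close>.\<close>

lemma Lambda_exists:
  assumes x: "x \<in> commuting_tuples r G" and B: "generate K (snd ` x ` {..<r}) = B"
  obtains H where "H \<in> Lambda A K \<theta> B" "x ` {..<r} \<subseteq> H"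
proof -
  let ?C = "fixed_points A \<theta> B \<times> {\<one>\<^bsub>K\<^esub>}"
  define S where "S = x ` {..<r} \<union> ?C"
  define H where "H = generate G S"
  have xG: "x i \<in> carrier G" if "i < r" for i
    using x that by (auto simp: commuting_tuples_def)
  have S: "S \<subseteq> carrier G"
    unfolding S_def
  proof (rule Un_least)
    show "x ` {..<r} \<subseteq> carrier G" using xG by blast
    show "?C \<subseteq> carrier G" by (auto simp: fixed_points_def)
  qed
  have xB: "snd (x i) \<in> B" if "i < r" for i
    using that B by (auto intro: generate.incl)
  have oneB: "\<one>\<^bsub>K\<^esub> \<in> B" using B by (auto intro: generate.one)
  have BK: "B \<subseteq> carrier K"
    unfolding B[symmetric] using xG by (intro K.generate_incl) fastforce
  have SB: "snd s \<in> B" if "s \<in> S" for s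
    using that xB oneB by (auto simp: S_def)
  \<comment> \<open>Every generator projects into \<open>B\<close>, including those in
    \<open>?C\<close>, which lie over the identity; so each fixes \<open>c\<close>.\<close>
  have central: "c \<otimes>\<^bsub>G\<^esub> s = s \<otimes>\<^bsub>G\<^esub> c" if "c \<in> ?C" "s \<in> S" for c s
    using that SB[OF that(2)] S commute_fixed_iff[of "fst c" "fst s" "snd s"]
    by (auto simp: fixed_points_def)
  have comm: "s \<otimes>\<^bsub>G\<^esub> t = t \<otimes>\<^bsub>G\<^esub> s" if "s \<in> S" "t \<in> S" for s t
  proof (cases "s \<in> ?C \<or> t \<in> ?C")
    case True
    then show ?thesis using central that by metis
  next
    case False
    then show ?thesis using x that by (auto simp: S_def commuting_tuples_def)
  qed
  have H: "comm_group (G\<lparr>carrier := H\<rparr>)"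
    unfolding H_def using S comm by (rule G.comm_group_generate)
  interpret H: comm_group "G\<lparr>carrier := H\<rparr>" by (rule H)
  \<comment> \<open>Adjoining \<open>?C\<close> does not enlarge the projection.\<close>
  have "generate K (snd ` S) = B"
  proof
    show "B \<subseteq> generate K (snd ` S)"
      unfolding B[symmetric] by (rule K.mono_generate) (auto simp: S_def)
    have "subgroup B K"
      unfolding B[symmetric] using xG by (intro K.generate_is_subgroup) fastforce
    then show "generate K (snd ` S) \<subseteq> B"
      using SB by (intro K.generate_subgroup_incl) auto
  qed
  then have HB: "snd ` H = B"
    unfolding H_def using proj.generate_img[OF S] by simp
  have HG: "subgroup H G"
    unfolding H_def using S by (rule G.generate_is_subgroup)
  have "H \<inter> (carrier A \<times> {\<one>\<^bsub>K\<^esub>}) = ?C"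
  proof
    show "?C \<subseteq> H \<inter> (carrier A \<times> {\<one>\<^bsub>K\<^esub>})"
      by (auto simp: H_def S_def fixed_points_def intro: generate.incl)
    \<comment> \<open>Each \<open>b\<close> lifts to an element of the abelian group
      \<open>H\<close>; commuting with that lift forces \<open>a\<close> to be fixed by
      \<open>b\<close>.\<close>
    have "\<theta> b a = a" if a: "(a, \<one>\<^bsub>K\<^esub>) \<in> H" "a \<in> carrier A" and b: "b \<in> B" for a b
    proof -
      obtain a' where a': "(a', b) \<in> H" using b HB by force
      then have "a' \<in> carrier A" "b \<in> carrier K"
        using subgroup.subset[OF HG] by auto
      then show ?thesis
        using H.m_comm[of "(a, \<one>\<^bsub>K\<^esub>)" "(a', b)"] a a' commute_fixed_iff[of a a' b] by simp
    qed
    then show "H \<inter> (carrier A \<times> {\<one>\<^bsub>K\<^esub>}) \<subseteq> ?C" by (auto simp: fixed_points_def)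
  qed
  then have "H \<in> Lambda A K \<theta> B"
    using HG H HB by (simp add: Lambda_def G_def)
  moreover have "x ` {..<r} \<subseteq> H"
    by (auto simp: H_def S_def intro: generate.incl)
  ultimately show ?thesis using that by blast
qed

text \<open>Any \<open>h\<close> in \<open>H\<close> has the same projection as some
  \<open>g\<close> in the subgroup generated by \<open>S\<close>, which lies in both groups. The
  quotient is a kernel element of \<open>H\<close>, hence in \<open>H'\<close>. Exchanging the roles
  gives uniqueness.\<close>

lemma Lambda_subset:
  assumes H: "H \<in> Lambda A K \<theta> B" and H': "H' \<in> Lambda A K \<theta> B"
    and S: "S \<subseteq> H" "S \<subseteq> H'" and B: "generate K (snd ` S) = B"
  shows "H \<subseteq> H'"
proof
  fix h assume h: "h \<in> H"
  note sub = LambdaD(1)[OF H] and sub' = LambdaD(1)[OF H']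
  have "S \<subseteq> carrier G" using S(1) subgroup.subset[OF sub] by blast
  then have "snd ` H = snd ` generate G S"
    using LambdaD(3)[OF H] B proj.generate_img by simp
  then obtain g where g: "g \<in> generate G S" "snd g = snd h"
    using h by (metis imageE imageI)
  then have gH: "g \<in> H" "g \<in> H'"
    using G.generate_subgroup_incl[OF S(1) sub] G.generate_subgroup_incl[OF S(2) sub'] by auto
  have G: "g \<in> carrier G" "h \<in> carrier G"
    using gH h subgroup.subset[OF sub] by blast+
  let ?c = "h \<otimes>\<^bsub>G\<^esub> inv\<^bsub>G\<^esub> g"
  have "?c \<in> H" using h gH subgroup.m_closed[OF sub] subgroup.m_inv_closed[OF sub] by blast
  moreover have "snd ?c = \<one>\<^bsub>K\<^esub>"
    using G g(2) by (rule proj_quotient_eq_one)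
  ultimately have "?c \<in> H'"
    using Lambda_kernel_iff[OF H, of ?c] Lambda_kernel_iff[OF H', of ?c]
      G.m_closed[OF G(2) G.inv_closed[OF G(1)]] by simp
  then have "?c \<otimes>\<^bsub>G\<^esub> g \<in> H'" using gH subgroup.m_closed[OF sub'] by blast
  then show "h \<in> H'" using G by (simp add: G.m_assoc del: carrier_G one_G)
qed

text \<open>Each fibre is a coset of the kernel part of \<open>H\<close>: right translation by one
  element \<open>g\<close> over \<open>b\<close> is a bijection onto it.\<close>

lemma card_fibre:
  assumes H: "H \<in> Lambda A K \<theta> B" and b: "b \<in> B"
  shows "card {h \<in> H. snd h = b} = card (fixed_points A \<theta> B)"
proof -
  let ?C = "fixed_points A \<theta> B \<times> {\<one>\<^bsub>K\<^esub>}"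
  note sub = LambdaD(1)[OF H]
  obtain g where g: "g \<in> H" "snd g = b" using LambdaD(3)[OF H] b by blast
  have HG: "h \<in> carrier G" if "h \<in> H" for h using that subgroup.subset[OF sub] by blast
  have C: "c \<in> H" "snd c = \<one>\<^bsub>K\<^esub>" if "c \<in> ?C" for c
    using that unfolding LambdaD(4)[OF H, symmetric] by (simp_all add: mem_Times_iff)
  have "bij_betw (\<lambda>c. c \<otimes>\<^bsub>G\<^esub> g) ?C {h \<in> H. snd h = b}"
  proof (rule bij_betw_byWitness[where f' = "\<lambda>h. h \<otimes>\<^bsub>G\<^esub> inv\<^bsub>G\<^esub> g"])
    show "\<forall>c\<in>?C. c \<otimes>\<^bsub>G\<^esub> g \<otimes>\<^bsub>G\<^esub> inv\<^bsub>G\<^esub> g = c"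
      using C HG g by (simp add: G.m_assoc del: carrier_G one_G)
    show "\<forall>h\<in>{h \<in> H. snd h = b}. h \<otimes>\<^bsub>G\<^esub> inv\<^bsub>G\<^esub> g \<otimes>\<^bsub>G\<^esub> g = h"
      using HG g by (simp add: G.m_assoc del: carrier_G one_G)
    show "(\<lambda>c. c \<otimes>\<^bsub>G\<^esub> g) ` ?C \<subseteq> {h \<in> H. snd h = b}"
    proof (intro image_subsetI CollectI conjI)
      fix c assume c: "c \<in> ?C"
      show "c \<otimes>\<^bsub>G\<^esub> g \<in> H" using C[OF c] g subgroup.m_closed[OF sub] by blast
      show "snd (c \<otimes>\<^bsub>G\<^esub> g) = b"
        using proj.hom_mult[OF HG[OF C(1)[OF c]] HG[OF g(1)]] proj.hom_closed[OF HG[OF g(1)]]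
          C(2)[OF c] g(2) by simp
    qed
    show "(\<lambda>h. h \<otimes>\<^bsub>G\<^esub> inv\<^bsub>G\<^esub> g) ` {h \<in> H. snd h = b} \<subseteq> ?C"
    proof (rule image_subsetI)
      fix h assume h: "h \<in> {h \<in> H. snd h = b}"
      then have "h \<otimes>\<^bsub>G\<^esub> inv\<^bsub>G\<^esub> g \<in> H"
        using g subgroup.m_closed[OF sub] subgroup.m_inv_closed[OF sub] by blast
      moreover have "snd (h \<otimes>\<^bsub>G\<^esub> inv\<^bsub>G\<^esub> g) = \<one>\<^bsub>K\<^esub>"
        using HG g h by (intro proj_quotient_eq_one) auto
      ultimately show "h \<otimes>\<^bsub>G\<^esub> inv\<^bsub>G\<^esub> g \<in> ?C"
        using Lambda_kernel_iff[OF H HG, of "h \<otimes>\<^bsub>G\<^esub> inv\<^bsub>G\<^esub> g"] by simp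
    qed
  qed
  then have "card ?C = card {h \<in> H. snd h = b}" by (rule bij_betw_same_card)
  then show ?thesis by (simp add: card_cartesian_product)
qed

section \<open>Counting commuting tuples in the semidirect product\<close>

lemma finite_Lambda_mem: "H \<in> Lambda A K \<theta> B \<Longrightarrow> finite H"
  by (rule finite_subset[OF subgroup.subset[OF LambdaD(1)]]) (simp_all add: finite_A finite_K)

text \<open>Tuples are sorted by their projection \<open>b\<close>. Over a fixed \<open>b\<close>
  the entries are chosen independently, each from a fibre whose size is given by
  \<open>card_fibre\<close>.\<close>

lemma card_tuples_over:
  assumes H: "H \<in> Lambda A K \<theta> B"
  shows "card (tuples_over K r H B) = card (fixed_points A \<theta> B) ^ r * gen_tuples K r B"
proof -
  let ?T = "{b \<in> {..<r} \<rightarrow>\<^sub>E B. generate K (b ` {..<r}) = B}"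
  let ?F = "\<lambda>b. \<Pi>\<^sub>E i\<in>{..<r}. {h \<in> H. snd h = b i}"
  note HB = LambdaD(3)[OF H]
  have finH: "finite H" using H by (rule finite_Lambda_mem)
  have "tuples_over K r H B = (\<Union>b\<in>?T. ?F b)"
  proof (intro equalityI subsetI)
    fix x assume x: "x \<in> tuples_over K r H B"
    let ?b = "\<lambda>i\<in>{..<r}. snd (x i)"
    have "?b ` {..<r} = snd ` x ` {..<r}" by force
    then have "?b \<in> ?T" using x HB by (auto simp: tuples_over_def)
    moreover have "x \<in> ?F ?b" using x by (auto simp: tuples_over_def PiE_iff)
    ultimately show "x \<in> (\<Union>b\<in>?T. ?F b)" by blast
  next
    fix x assume "x \<in> (\<Union>b\<in>?T. ?F b)"
    then obtain b where b: "b \<in> ?T" and x: "x \<in> ?F b" by blast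
    have "snd ` x ` {..<r} = b ` {..<r}" using x by (force simp: PiE_iff image_iff)
    then show "x \<in> tuples_over K r H B"
      using b x by (auto simp: tuples_over_def PiE_iff)
  qed
  moreover have "card (\<Union>b\<in>?T. ?F b) = (\<Sum>b\<in>?T. card (?F b))"
  proof (intro card_UN_disjoint ballI impI)
    show "finite ?T" using finH HB by (auto simp: finite_PiE)
    show "finite (?F b)" for b using finH by (auto intro!: finite_PiE)
    fix b b' assume b: "b \<in> ?T" "b' \<in> ?T" "b \<noteq> b'"
    \<comment> \<open>The projections of the entries of \<open>x\<close> recover \<open>b\<close>,
      so distinct \<open>b\<close> give disjoint blocks.\<close>
    have "b = b'" if "x \<in> ?F b" "x \<in> ?F b'" for x
    proof (rule PiE_ext)
      show "b \<in> {..<r} \<rightarrow>\<^sub>E B" "b' \<in> {..<r} \<rightarrow>\<^sub>E B" using b by auto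
      show "b i = b' i" if "i \<in> {..<r}" for i
        using that \<open>x \<in> ?F b\<close> \<open>x \<in> ?F b'\<close> by (auto simp: PiE_iff)
    qed
    then show "?F b \<inter> ?F b' = {}" using b(3) by blast
  qed
  moreover have "card (?F b) = card (fixed_points A \<theta> B) ^ r" if "b \<in> ?T" for b
  proof -
    have "card (?F b) = (\<Prod>i<r. card {h \<in> H. snd h = b i})" by (simp add: card_PiE)
    also have "\<dots> = (\<Prod>i<r. card (fixed_points A \<theta> B))"
      using that by (intro prod.cong refl card_fibre[OF H]) auto
    finally show ?thesis by simp
  qed
  ultimately show ?thesis by (simp add: gen_tuples_def)
qed

text \<open>The blocks \<open>tuples_over K r H B\<close> partition the commuting tuples:
  \<open>Lambda_exists\<close> shows that they cover, \<open>Lambda_subset\<close> that they are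
  disjoint.\<close>

lemma card_commuting_tuples:
  "card (commuting_tuples r G)
    = (\<Sum>B | subgroup B K. lambda A K \<theta> B * card (fixed_points A \<theta> B) ^ r * gen_tuples K r B)"
proof -
  let ?I = "SIGMA B:{B. subgroup B K}. Lambda A K \<theta> B"
  let ?T = "\<lambda>(B, H). tuples_over K r H B"
  have "commuting_tuples r G = (\<Union>p\<in>?I. ?T p)"
  proof (intro equalityI subsetI)
    fix x assume x: "x \<in> commuting_tuples r G"
    let ?B = "generate K (snd ` x ` {..<r})"
    obtain H where H: "H \<in> Lambda A K \<theta> ?B" "x ` {..<r} \<subseteq> H"
      using Lambda_exists[OF x refl] .
    have "snd ` x ` {..<r} \<subseteq> carrier K"
      using x by (fastforce simp: commuting_tuples_def PiE_iff)
    then have "(?B, H) \<in> ?I" using H K.generate_is_subgroup by simp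
    moreover have "x \<in> ?T (?B, H)"
      using x H by (auto simp: tuples_over_def commuting_tuples_def PiE_iff)
    ultimately show "x \<in> (\<Union>p\<in>?I. ?T p)" by blast
  next
    fix x assume "x \<in> (\<Union>p\<in>?I. ?T p)"
    then obtain B H where H: "H \<in> Lambda A K \<theta> B" and x: "x \<in> tuples_over K r H B" by blast
    then show "x \<in> commuting_tuples r G"
      using LambdaD(2)[OF H] subgroup.subset[OF LambdaD(1)[OF H]]
      by (auto simp: tuples_over_def commuting_tuples_def PiE_iff simp del: carrier_G)
  qed
  moreover have "card (\<Union>p\<in>?I. ?T p) = (\<Sum>p\<in>?I. card (?T p))"
  proof (intro card_UN_disjoint ballI impI)
    show "finite ?I"
      using K.finite_subgroups[OF finite_K] finite_Lambda by (intro finite_SigmaI) auto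
    show "finite (?T p)" if "p \<in> ?I" for p
      using that finite_Lambda_mem by (auto simp: tuples_over_def finite_PiE)
    fix p q assume p: "p \<in> ?I" and q: "q \<in> ?I" and "p \<noteq> q"
    have "p = q" if "x \<in> ?T p" "x \<in> ?T q" for x
    proof -
      obtain B H B' H' where pq: "p = (B, H)" "q = (B', H')" by (cases p, cases q)
      have x: "x \<in> tuples_over K r H B" "x \<in> tuples_over K r H' B'"
        using that pq by simp_all
      then have "x \<in> {..<r} \<rightarrow>\<^sub>E H" "x \<in> {..<r} \<rightarrow>\<^sub>E H'"
        unfolding tuples_over_def by blast+
      then have sub: "x ` {..<r} \<subseteq> H" "x ` {..<r} \<subseteq> H'"
        by (simp_all add: PiE_iff image_subset_iff)
      have B: "generate K (snd ` x ` {..<r}) = B" and B': "generate K (snd ` x ` {..<r}) = B'"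
        using x unfolding tuples_over_def by blast+
      \<comment> \<open>The tuple determines \<open>B\<close> as the subgroup generated by its
        projections; inclusion in both directions then determines \<open>H\<close>.\<close>
      have "B' = B" by (rule trans[OF B'[symmetric] B])
      then have "H \<in> Lambda A K \<theta> B" "H' \<in> Lambda A K \<theta> B" using p q pq by simp_all
      then have "H = H'"
        using Lambda_subset[OF _ _ sub B] Lambda_subset[OF _ _ sub(2,1) B] by blast
      then show ?thesis using \<open>B' = B\<close> pq by simp
    qed
    then show "?T p \<inter> ?T q = {}" using \<open>p \<noteq> q\<close> by blast
  qed
  moreover have "\<dots> = (\<Sum>B | subgroup B K. \<Sum>H\<in>Lambda A K \<theta> B. card (tuples_over K r H B))"
    using K.finite_subgroups[OF finite_K] finite_Lambda
    by (subst sum.Sigma) (auto simp: case_prod_beta)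
  moreover have "\<dots> = (\<Sum>B | subgroup B K.
      lambda A K \<theta> B * card (fixed_points A \<theta> B) ^ r * gen_tuples K r B)"
    by (intro sum.cong refl) (simp add: card_tuples_over lambda_def)
  ultimately show ?thesis by simp
qed

end

theorem theorem4p4:
  fixes A :: "('a, 'm) monoid_scheme"
    and K :: "('k, 'n) monoid_scheme"
    and \<theta> :: "'k \<Rightarrow> 'a \<Rightarrow> 'a"
    and r :: nat
  assumes "comm_group A" and "finite (carrier A)"
    and "comm_group K" and "finite (carrier K)"
    and "\<theta> \<in> hom K (AutoGroup A)"
    and "r \<ge> 1"
  shows "card (Hom_Zpow r (semidirect_product A K \<theta>))
           = (\<Sum>B | subgroup B K. lambda A K \<theta> B * card (fixed_points A \<theta> B) ^ r * gen_tuples K r B) \<and>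
         (\<forall>B. subgroup B K \<longrightarrow>
           int (gen_tuples K r B)
             = (\<Sum>D | subgroup D K \<and> D \<subseteq> B. moebius {H. subgroup H K} D B * int (card D) ^ r)) \<and>
         int (card (Hom_Zpow r (semidirect_product A K \<theta>)))
           = (\<Sum>B | subgroup B K. \<Sum>D | subgroup D K \<and> D \<subseteq> B.
                int (lambda A K \<theta> B) * moebius {H. subgroup H K} D B
                  * (int (card (fixed_points A \<theta> B)) * int (card D)) ^ r)"
proof -
  interpret semidirect A K \<theta>
    using assms by (simp add: semidirect_def semidirect_axioms_def)
  have count: "card (Hom_Zpow r (semidirect_product A K \<theta>))
      = (\<Sum>B | subgroup B K. lambda A K \<theta> B * card (fixed_points A \<theta> B) ^ r * gen_tuples K r B)"
    using G.card_Hom_Zpow card_commuting_tuples by (simp add: G_def)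
  have gen: "int (gen_tuples K r B)
      = (\<Sum>D | subgroup D K \<and> D \<subseteq> B. moebius {H. subgroup H K} D B * int (card D) ^ r)"
    if "subgroup B K" for B
    using K.gen_tuples_eq_sum_moebius[OF finite_K that] .
  have "int (card (Hom_Zpow r (semidirect_product A K \<theta>)))
      = (\<Sum>B | subgroup B K. int (lambda A K \<theta> B) * int (card (fixed_points A \<theta> B)) ^ r
          * int (gen_tuples K r B))"
    by (simp add: count)
  \<comment> \<open>Substituting the Moebius formula for \<open>gen_tuples K r B\<close> and merging
    the two \<open>r\<close>-th powers.\<close>
  also have "\<dots> = (\<Sum>B | subgroup B K. \<Sum>D | subgroup D K \<and> D \<subseteq> B.
      int (lambda A K \<theta> B) * moebius {H. subgroup H K} D B
        * (int (card (fixed_points A \<theta> B)) * int (card D)) ^ r)"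
    by (intro sum.cong refl)
      (simp add: gen sum_distrib_left power_mult_distrib mult_ac)
  finally show ?thesis using count gen by blast
qed

end
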